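(* Let $M=M_\epsilon(0)$ be a fixed real $n\times n$ matrix that evolves according to $\dot M_\epsilon(t)=P_\epsilon(t)$, where $P_\epsilon(t)=\sum_{m\ge 0}P(t_m)\,W_\epsilon(t;t_m,t_{m+1})$ is the smoothened stochastic impulse defined in the context. Then the expected force of attraction of complex conjugate eigenvalues is directly proportional to the square of the $2$-norm of the left eigenvector and to the variance of the entries of the perturbation matrix. Precisely, let $t\in[t_m,t_{m+1})$, let the eigenvalues of $M_\epsilon(t_m)$ be simple, let the eigenvalues and eigenvectors $\lambda_i,\mathbf{v}_i,\mathbf{u}_i$ be taken to be those of $M_\epsilon(t_m)$, and let $\mathbb{E}[p^2]$ denote the common variance of the entries of $P_\epsilon(t)$. Then for every non-real $\lambda_i$, $$\mathbb{E}\left[\text{force of }\overline{\lambda_i}\text{ on }\lambda_i\right]=-i\,\frac{\mathbb{E}[p^2]\,\|\mathbf{u}_i\|_2^2}{\mathrm{Im}(\lambda_i)},$$ where the expectation is over $P(t_m)$, conditionally on $P(t_0),\dots,P(t_{m-1})$, and the prefactor $i$ is the imaginary unit.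
   Context: Setting. $0=t_0<t_1<\cdots$ is a discretization of time. $P(t_0),P(t_1),\dots$ are mutually independent real random $n\times n$ matrices, each with independent, identically distributed entries of mean zero and finite fourth moments. $\epsilon>0$ satisfies $\epsilon<(t_{m+1}-t_m)/2$ for all $m$. The window function $W_\epsilon(t;t_m,t_{m+1})$ vanishes outside $[t_m,t_{m+1}]$, equals $1$ for $t_m+\epsilon<t<t_{m+1}-\epsilon$, equals $\exp\!\left(1-\frac{1}{1-[(t-t_m-\epsilon)/\epsilon]^2}\right)$ for $t_m\le t\le t_m+\epsilon$, and equals $\exp\!\left(1-\frac{1}{1-[(t-t_{m+1}+\epsilon)/\epsilon]^2}\right)$ for $t_{m+1}-\epsilon\le t\le t_{m+1}$ (with value $0$ at $t=t_m$ and $t=t_{m+1}$). Eigenvectors. $\mathbf{v}_i$ is a unit ($2$-norm) right eigenvector for $\lambda_i$, and $\mathbf{u}_i^*$ are the dual left eigenvectors, normalized by $\mathbf{u}_j^*\mathbf{v}_i=\delta_{ij}$. The eigenvectors of $\overline{\lambda_i}$ are taken to be $\overline{\mathbf{v}_i},\overline{\mathbf{u}_i}$. Forces. With $c_{ij}=\mathbf{u}_i^*P_\epsilon(t)\mathbf{v}_j$, the force of $\lambda_j$ on $\lambda_i$ is by definition $\dfrac{2c_{ij}c_{ji}}{\lambda_i-\lambda_j}$. For $\lambda_j=\overline{\lambda_i}$ this equals $\dfrac{2\,(\mathbf{u}_i^*P_\epsilon(t)\overline{\mathbf{v}_i})(\mathbf{u}_i^TP_\epsilon(t)\mathbf{v}_i)}{\lambda_i-\overline{\lambda_i}}$.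 *)

theory Defs
  imports "HOL-Probability.Probability" "HOL-Computational_Algebra.Polynomial"
begin

text \<open>At the end points \<open>s = a\<close>, \<open>s = b\<close> the exponential formulas would divide by zero
  (and evaluate to \<open>exp 1\<close>), so the value \<open>0\<close> is imposed there.\<close>

definition window :: "real \<Rightarrow> real \<Rightarrow> real \<Rightarrow> real \<Rightarrow> real" where
  "window \<epsilon> a b s =
     (if s \<le> a \<or> b \<le> s then 0
      else if s \<le> a + \<epsilon> then exp (1 - 1 / (1 - ((s - a - \<epsilon>) / \<epsilon>)\<^sup>2))
      else if s < b - \<epsilon> then 1
      else exp (1 - 1 / (1 - ((s - b + \<epsilon>) / \<epsilon>)\<^sup>2)))"

definition impulse ::
  "real \<Rightarrow> (nat \<Rightarrow> real) \<Rightarrow> (nat \<Rightarrow> 'a \<Rightarrow> real^'n^'n) \<Rightarrow> real \<Rightarrow> 'a \<Rightarrow> real^'n^'n" where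
  "impulse \<epsilon> t P s \<omega> = (\<Sum>m. window \<epsilon> (t m) (t (Suc m)) s *\<^sub>R P m \<omega>)"

definition past :: "'a measure \<Rightarrow> (nat \<Rightarrow> 'a \<Rightarrow> 'b::topological_space) \<Rightarrow> nat \<Rightarrow> 'a measure" where
  "past \<Omega> P m = sigma (space \<Omega>) (\<Union>k<m. {P k -` A \<inter> space \<Omega> | A. A \<in> sets borel})"

text \<open>\<^const>\<open>real_cond_exp\<close> is the difference of the conditional expectations of the positive and
  the negative part, hence meaningful at every point where the conditional expectation of the
  modulus is finite, without global integrability.\<close>

definition complex_cond_exp ::
  "'a measure \<Rightarrow> 'a measure \<Rightarrow> ('a \<Rightarrow> complex) \<Rightarrow> 'a \<Rightarrow> complex" where
  "complex_cond_exp M F f \<omega> =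
     Complex (real_cond_exp M F (\<lambda>x. Re (f x)) \<omega>) (real_cond_exp M F (\<lambda>x. Im (f x)) \<omega>)"

abbreviation cmatrix :: "real^'n^'m \<Rightarrow> complex^'n^'m" where
  "cmatrix A \<equiv> map_matrix complex_of_real A"

definition cnj_vec :: "complex^'n \<Rightarrow> complex^'n" where
  "cnj_vec x = (\<chi> k. cnj (x $ k))"

text \<open>\<open>herm x y\<close> is \<open>x\<^sup>* y\<close>, conjugate-linear in the first argument.\<close>

definition herm :: "complex^'n \<Rightarrow> complex^'n \<Rightarrow> complex" where
  "herm x y = (\<Sum>k\<in>UNIV. cnj (x $ k) * y $ k)"

definition charpoly :: "complex^'n^'n \<Rightarrow> complex poly" where
  "charpoly A = det (mat [:0, 1:] - map_matrix (\<lambda>a. [:a:]) A)"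

definition simple_spectrum :: "complex^'n^'n \<Rightarrow> bool" where
  "simple_spectrum A \<longleftrightarrow> (\<forall>z. poly (charpoly A) z = 0 \<longrightarrow> order z (charpoly A) = 1)"

text \<open>A full labelling, by the index type, of the eigenvalues of a matrix with simple spectrum,
  together with unit right eigenvectors and dual left eigenvectors (\<open>u\<^sup>* A = \<lambda> u\<^sup>*\<close>),
  chosen compatibly with complex conjugation.\<close>

definition eigen_system ::
  "complex^'n^'n \<Rightarrow> ('n \<Rightarrow> complex) \<Rightarrow> ('n \<Rightarrow> complex^'n) \<Rightarrow> ('n \<Rightarrow> complex^'n) \<Rightarrow> bool" where
  "eigen_system A lam v u \<longleftrightarrow>
     bij_betw lam UNIV {z. poly (charpoly A) z = 0} \<and>
     (\<forall>i. A *v v i = lam i *s v i \<and> norm (v i) = 1) \<and>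
     (\<forall>i. cnj_vec (u i) v* A = lam i *s cnj_vec (u i)) \<and>
     (\<forall>i j. herm (u j) (v i) = (if i = j then 1 else 0)) \<and>
     (\<forall>i j. lam j = cnj (lam i) \<longrightarrow> v j = cnj_vec (v i) \<and> u j = cnj_vec (u i))"

definition coupling ::
  "complex^'n^'n \<Rightarrow> ('n \<Rightarrow> complex^'n) \<Rightarrow> ('n \<Rightarrow> complex^'n) \<Rightarrow> 'n \<Rightarrow> 'n \<Rightarrow> complex" where
  "coupling Q v u i j = herm (u i) (Q *v v j)"

text \<open>The force exerted by \<open>lam j\<close> on \<open>lam i\<close> when the velocity of the matrix is \<open>Q\<close>.\<close>

definition force ::
  "complex^'n^'n \<Rightarrow> ('n \<Rightarrow> complex) \<Rightarrow> ('n \<Rightarrow> complex^'n) \<Rightarrow> ('n \<Rightarrow> complex^'n) \<Rightarrow> 'n \<Rightarrow> 'n \<Rightarrow> complex"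
  where
  "force Q lam v u i j = 2 * coupling Q v u i j * coupling Q v u j i / (lam i - lam j)"

end

theory Submission
  imports Defs
begin

text \<open>
  The velocity of the matrix at time \<open>\<tau>\<close> is \<open>w P(t\<^sub>m)\<close> with a deterministic weight \<open>w\<close>, because all
  other windows vanish at \<open>\<tau>\<close>.  Each coupling \<open>u\<^sub>i\<^sup>* Q v\<^sub>j\<close> is linear in the entries of \<open>Q\<close>, so
  the force is a finite sum \<open>\<Sum> C\<^sub>p\<^sub>q X\<^sub>p\<^sub>q\<close> in which \<open>C\<^sub>p\<^sub>q\<close> is a function of the eigenvalues and
  eigenvectors, hence of the past, and \<open>X\<^sub>p\<^sub>q\<close> is the product of the entries of \<open>P(t\<^sub>m)\<close> at the
  positions \<open>p\<close> and \<open>q\<close>, which is independent of the past.  Conditioning on the past therefore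
  replaces \<open>X\<^sub>p\<^sub>q\<close> by its mean (\<open>complex_cond_exp_predictable_combination\<close>).  The entries are
  centred, independent and identically distributed, so this mean is their variance for \<open>p = q\<close> and
  \<open>0\<close> otherwise (\<open>expectation_product_centered_iid\<close>), and only the diagonal coefficients survive.

  If \<open>\<lambda>\<^sub>j\<close> is the conjugate of \<open>\<lambda>\<^sub>i\<close>, the diagonal coefficient at \<open>(a, b)\<close> is
  \<open>2 \<bar>u\<^sub>i(a)\<bar>\<^sup>2 \<bar>v\<^sub>i(b)\<bar>\<^sup>2 / (\<lambda>\<^sub>i - \<lambda>\<^sub>j)\<close>.  The sum over \<open>a\<close> and \<open>b\<close> factorises into the squared norms of
  \<open>u\<^sub>i\<close> and of the unit vector \<open>v\<^sub>i\<close>, while \<open>\<lambda>\<^sub>i - \<lambda>\<^sub>j = 2 \<i> Im \<lambda>\<^sub>i\<close>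
  (\<open>sum_force_coeff_diagonal\<close>).  That a conjugate index \<open>j\<close> exists is due to the
  characteristic polynomial of a real matrix having real coefficients.

  The one analytic obstacle is that the coefficients \<open>C\<^sub>p\<^sub>q\<close> need not be bounded, nor the force
  integrable: left eigenvectors can become arbitrarily long as eigenvalues approach each other.  The
  conditional expectation nevertheless commutes with multiplication by any nonnegative
  past-measurable function \<open>g\<close>.  With \<open>g = 1 / (1 + \<Sum> \<bar>C\<^sub>p\<^sub>q\<bar>)\<close> the product is integrable, the
  classical rules apply to it, and \<open>g > 0\<close> can be cancelled afterwards.  The index \<open>j\<close> depends on
  the sample point, so the formula is established almost surely for the finitely many pairs
  \<open>(i, j)\<close> at once, before \<open>j\<close> is chosen.
\<close>

section \<open>Conditional expectations of linear combinations with predictable coefficients\<close>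

text \<open>A nonnegative factor does not mix the positive and the negative part of \<open>f\<close>, so it can be
  pulled out of the two \<open>[0, \<infinity>]\<close>-valued conditional expectations separately.  The normalisation
  of non-integrable functions by a weight rests on this.\<close>

lemma (in sigma_finite_subalgebra) real_cond_exp_mult_nonneg:
  assumes [measurable]: "g \<in> borel_measurable F" "f \<in> borel_measurable M"
    and pos: "\<And>x. 0 \<le> g x"
  shows "AE x in M. real_cond_exp M F (\<lambda>x. g x * f x) x = g x * real_cond_exp M F f x"
proof -
  have 1: "AE x in M. ennreal (g x) * nn_cond_exp M F (\<lambda>x. ennreal (f x)) x
      = nn_cond_exp M F (\<lambda>x. ennreal (g x) * ennreal (f x)) x"
    by (rule nn_cond_exp_prod) auto
  have 2: "AE x in M. ennreal (g x) * nn_cond_exp M F (\<lambda>x. ennreal (- f x)) x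
      = nn_cond_exp M F (\<lambda>x. ennreal (g x) * ennreal (- f x)) x"
    by (rule nn_cond_exp_prod) auto
  have e: "ennreal (g x * y) = ennreal (g x) * ennreal y" for x y
    by (rule ennreal_mult') (rule pos)
  show ?thesis
    using 1 2
  proof eventually_elim
    case (elim x)
    have e2: "ennreal (- (g x * f x)) = ennreal (g x) * ennreal (- f x)" for x
      using e[of x "- f x"] by simp
    show ?case
      unfolding real_cond_exp_def e e2 elim[symmetric]
      by (simp add: enn2real_mult pos right_diff_distrib)
  qed
qed

lemma (in sigma_finite_subalgebra) nn_cond_exp_finite:
  assumes f [measurable]: "f \<in> borel_measurable M" and fin: "(\<integral>\<^sup>+ x. f x \<partial>M) < \<infinity>"
  shows "AE x in M. nn_cond_exp M F f x < \<infinity>"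
proof -
  have "(\<integral>\<^sup>+ x. nn_cond_exp M F f x \<partial>M) = (\<integral>\<^sup>+ x. f x \<partial>M)"
    using nn_cond_exp_intg[of "\<lambda>_. 1" f] by simp
  then have "AE x in M. nn_cond_exp M F f x \<noteq> \<infinity>"
    using fin by (intro nn_integral_PInf_AE) auto
  then show ?thesis by (simp add: less_top)
qed

lemma (in prob_space) indep_set_mono:
  assumes "indep_set A B" "A' \<subseteq> A" "B' \<subseteq> B"
  shows "indep_set A' B'"
  using assms(1) unfolding indep_set_def
  by (rule indep_sets_mono_sets) (use assms(2,3) in \<open>auto split: bool.splits\<close>)

lemma (in prob_space) real_cond_exp_indep:
  fixes X :: "'a \<Rightarrow> real"
  assumes sub: "subalgebra M F" and X: "integrable M X"
    and ind: "indep_set (sets F) (sets (vimage_algebra (space M) X borel))"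
  shows "AE x in M. real_cond_exp M F X x = expectation X"
proof -
  interpret finite_measure_subalgebra M F
    by unfold_locales (rule sub)
  show ?thesis
  proof (rule real_cond_exp_charact)
    fix A assume A: "A \<in> sets F"
    then have AM: "A \<in> events" using sub by (auto simp: subalgebra_def)
    have "indicat_real A \<in> borel_measurable F" using A by simp
    then have "{indicat_real A -` B \<inter> space M | B. B \<in> sets borel} \<subseteq> sets F"
      using sub by (auto simp: subalgebra_def measurable_def)
    then have "sigma_sets (space M) {indicat_real A -` B \<inter> space M | B. B \<in> sets borel} \<subseteq> sets F"
      using sub sets.sigma_sets_subset[of _ F] by (simp add: subalgebra_def)
    then have i: "indep_var borel (indicat_real A) borel X"
      unfolding indep_var_eq using AM X
      by (auto intro: indep_set_mono[OF ind] simp: sets_vimage_algebra)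
    have "(\<integral>x. indicat_real A x * X x \<partial>M) = expectation (indicat_real A) * expectation X"
      by (rule indep_var_lebesgue_integral[OF i _ X])
         (use AM in \<open>simp add: integrable_indicator_iff emeasure_eq_measure\<close>)
    then show "(\<integral>x\<in>A. X x \<partial>M) = (\<integral>x\<in>A. expectation X \<partial>M)"
      using AM by (simp add: set_lebesgue_integral_def)
  qed (auto intro: X)
qed

text \<open>The coefficients are normalised by the weight \<open>1 / (1 + \<Sum> \<bar>C\<^sub>i\<bar>)\<close>, which makes them bounded
  by \<open>1\<close>.  The usual rules for integrable products then give the formula up to this weight, which
  is positive and cancels.\<close>

lemma (in prob_space) real_cond_exp_predictable_combination:
  fixes C X :: "'i \<Rightarrow> 'a \<Rightarrow> real"
  assumes sub: "subalgebra M F" and I: "finite I"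
    and X: "\<And>i. integrable M (X i)" 
    and ind: "\<And>i. indep_set (sets F) (sets (vimage_algebra (space M) (X i) borel))"
    and C [measurable]: "\<And>i. C i \<in> borel_measurable F"
  shows "AE x in M. real_cond_exp M F (\<lambda>x. \<Sum>i\<in>I. C i x * X i x) x
           = (\<Sum>i\<in>I. C i x * expectation (X i))"
proof -
  interpret finite_measure_subalgebra M F
    by unfold_locales (rule sub)
  define g where "g x = inverse (1 + (\<Sum>i\<in>I. \<bar>C i x\<bar>))" for x
  have den: "0 < 1 + (\<Sum>i\<in>I. \<bar>C i x\<bar>)" for x
    by (rule add_pos_nonneg) (auto intro: sum_nonneg)
  have gpos: "0 < g x" for x using den by (simp add: g_def)
  have gm [measurable]: "g \<in> borel_measurable F" unfolding g_def by measurable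
  have XM [measurable]: "X i \<in> borel_measurable M" for i
    using X by auto
  have CM [measurable]: "C i \<in> borel_measurable M" for i
    by (rule measurable_from_subalg[OF sub C])
  have gM [measurable]: "g \<in> borel_measurable M"
    by (rule measurable_from_subalg[OF sub gm])
  \<comment> \<open>\<open>real_cond_exp_sum\<close> asks for integrability at every index, hence the value \<open>0\<close> outside \<open>I\<close>.\<close>
  define D where "D i = (\<lambda>x. if i \<in> I then g x * C i x else 0)" for i
  have Dm [measurable]: "D i \<in> borel_measurable F" for i
    unfolding D_def by measurable
  have DM [measurable]: "D i \<in> borel_measurable M" for i
    by (rule measurable_from_subalg[OF sub Dm])
  have D1: "\<bar>D i x\<bar> \<le> 1" for i x
  proof (cases "i \<in> I")
    case True
    have "\<bar>C i x\<bar> \<le> (\<Sum>i\<in>I. \<bar>C i x\<bar>)"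
      by (rule member_le_sum) (use I True in auto)
    then show ?thesis
      using den[of x] True by (simp add: D_def g_def abs_mult field_simps)
  qed (simp add: D_def)
  have int: "integrable M (\<lambda>x. D i x * X i x)" for i
    by (rule Bochner_Integration.integrable_bound[OF X[of i]])
       (auto simp: abs_mult intro!: mult_left_le_one_le D1)
  have 1: "AE x in M. \<forall>i\<in>I. real_cond_exp M F (\<lambda>x. D i x * X i x) x = D i x * expectation (X i)"
  proof (rule AE_finite_allI[OF I])
    fix i
    have "AE x in M. real_cond_exp M F (\<lambda>x. D i x * X i x) x = D i x * real_cond_exp M F (X i) x"
      by (rule real_cond_exp_mult) (use int in auto)
    then show "AE x in M. real_cond_exp M F (\<lambda>x. D i x * X i x) x = D i x * expectation (X i)"
      using real_cond_exp_indep[OF sub X ind, of i] by eventually_elim simp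
  qed
  have 2: "AE x in M. real_cond_exp M F (\<lambda>x. \<Sum>i\<in>I. D i x * X i x) x
      = (\<Sum>i\<in>I. real_cond_exp M F (\<lambda>x. D i x * X i x) x)"
    by (rule real_cond_exp_sum) (rule int)
  have 3: "AE x in M. real_cond_exp M F (\<lambda>x. g x * (\<Sum>i\<in>I. C i x * X i x)) x
      = g x * real_cond_exp M F (\<lambda>x. \<Sum>i\<in>I. C i x * X i x) x"
    by (rule real_cond_exp_mult_nonneg) (use gpos in \<open>auto intro: less_imp_le\<close>)
  have e: "(\<lambda>x. g x * (\<Sum>i\<in>I. C i x * X i x)) = (\<lambda>x. \<Sum>i\<in>I. D i x * X i x)"
    by (auto simp: D_def sum_distrib_left mult.assoc intro!: sum.cong)
  show ?thesis
    using 1 2 3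
  proof eventually_elim
    case (elim x)
    have "g x * real_cond_exp M F (\<lambda>x. \<Sum>i\<in>I. C i x * X i x) x
        = (\<Sum>i\<in>I. D i x * expectation (X i))"
      using elim by (simp add: e)
    also have "\<dots> = g x * (\<Sum>i\<in>I. C i x * expectation (X i))"
      by (auto simp: D_def sum_distrib_left mult.assoc intro!: sum.cong)
    finally show ?case using gpos[of x] by simp
  qed
qed

text \<open>The same weight brings the modulus below the integrable \<open>\<Sum> \<bar>X\<^sub>i\<bar>\<close>.  An integrable function has
  an almost surely finite conditional expectation, and dividing by the positive finite weight
  preserves finiteness.\<close>

lemma (in prob_space) nn_cond_exp_predictable_combination_finite:
  fixes C :: "'i \<Rightarrow> 'a \<Rightarrow> complex" and X :: "'i \<Rightarrow> 'a \<Rightarrow> real"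
  assumes sub: "subalgebra M F" and I: "finite I"
    and X: "\<And>i. integrable M (X i)" and C [measurable]: "\<And>i. C i \<in> borel_measurable F"
  shows "AE x in M.
    nn_cond_exp M F (\<lambda>x. ennreal (cmod (\<Sum>i\<in>I. C i x * complex_of_real (X i x)))) x < \<infinity>"
proof -
  interpret finite_measure_subalgebra M F
    by unfold_locales (rule sub)
  define g where "g x = inverse (1 + (\<Sum>i\<in>I. cmod (C i x)))" for x
  have den: "0 < 1 + (\<Sum>i\<in>I. cmod (C i x))" for x
    by (rule add_pos_nonneg) (auto intro: sum_nonneg)
  have gpos: "0 < g x" for x using den by (simp add: g_def)
  have gm [measurable]: "g \<in> borel_measurable F" unfolding g_def by measurable
  have XM [measurable]: "X i \<in> borel_measurable M" for i
    using X by auto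
  have CM [measurable]: "C i \<in> borel_measurable M" for i
    by (rule measurable_from_subalg[OF sub C])
  have gM [measurable]: "g \<in> borel_measurable M"
    by (rule measurable_from_subalg[OF sub gm])
  let ?f = "\<lambda>x. \<Sum>i\<in>I. C i x * complex_of_real (X i x)"
  have gC: "g x * cmod (C i x) \<le> 1" if "i \<in> I" for i x
  proof -
    have "cmod (C i x) \<le> (\<Sum>i\<in>I. cmod (C i x))"
      by (rule member_le_sum) (use I that in auto)
    then show ?thesis using den[of x] by (simp add: g_def field_simps)
  qed
  have bound: "g x * cmod (?f x) \<le> (\<Sum>i\<in>I. \<bar>X i x\<bar>)" for x
  proof -
    have "g x * cmod (?f x) \<le> g x * (\<Sum>i\<in>I. cmod (C i x) * \<bar>X i x\<bar>)"
      using gpos[of x] by (intro mult_left_mono order_trans[OF norm_sum])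
        (auto simp: norm_mult intro: less_imp_le)
    also have "\<dots> = (\<Sum>i\<in>I. g x * cmod (C i x) * \<bar>X i x\<bar>)"
      by (simp add: sum_distrib_left mult.assoc)
    also have "\<dots> \<le> (\<Sum>i\<in>I. \<bar>X i x\<bar>)"
      by (intro sum_mono mult_left_le_one_le)
         (use gC less_imp_le[OF gpos] in \<open>auto intro: mult_nonneg_nonneg\<close>)
    finally show ?thesis .
  qed
  have "integrable M (\<lambda>x. \<Sum>i\<in>I. \<bar>X i x\<bar>)"
    using X by (intro Bochner_Integration.integrable_sum integrable_abs)
  then have "integrable M (\<lambda>x. g x * cmod (?f x))"
  proof (rule Bochner_Integration.integrable_bound)
    have "norm (g x * cmod (?f x)) \<le> norm (\<Sum>i\<in>I. \<bar>X i x\<bar>)" for x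
      using bound[of x] less_imp_le[OF gpos[of x]] by (simp add: abs_mult)
    then show "AE x in M. norm (g x * cmod (?f x)) \<le> norm (\<Sum>i\<in>I. \<bar>X i x\<bar>)"
      by simp
  qed auto
  then have "(\<integral>\<^sup>+ x. ennreal (g x * cmod (?f x)) \<partial>M) < \<infinity>"
    using less_imp_le[OF gpos] by (subst nn_integral_eq_integral) auto
  then have 1: "AE x in M. nn_cond_exp M F (\<lambda>x. ennreal (g x * cmod (?f x))) x < \<infinity>"
    by (intro nn_cond_exp_finite) auto
  have 2: "AE x in M. ennreal (g x) * nn_cond_exp M F (\<lambda>x. ennreal (cmod (?f x))) x
      = nn_cond_exp M F (\<lambda>x. ennreal (g x) * ennreal (cmod (?f x))) x"
    by (rule nn_cond_exp_prod) auto
  have e: "ennreal (g x * y) = ennreal (g x) * ennreal y" for x y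
    by (rule ennreal_mult') (rule less_imp_le[OF gpos])
  show ?thesis
    using 1 2
  proof eventually_elim
    case (elim x)
    then have "ennreal (g x) * nn_cond_exp M F (\<lambda>x. ennreal (cmod (?f x))) x < \<top>"
      by (simp add: e)
    moreover have "ennreal (g x) \<noteq> 0" using gpos[of x] by simp
    ultimately show ?case by (auto simp: ennreal_mult_less_top less_top)
  qed
qed

lemma (in prob_space) complex_cond_exp_predictable_combination:
  fixes C :: "'i \<Rightarrow> 'a \<Rightarrow> complex" and X :: "'i \<Rightarrow> 'a \<Rightarrow> real"
  assumes sub: "subalgebra M F" and I: "finite I"
    and X: "\<And>i. integrable M (X i)" 
    and ind: "\<And>i. indep_set (sets F) (sets (vimage_algebra (space M) (X i) borel))"
    and C [measurable]: "\<And>i. C i \<in> borel_measurable F"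
  shows "AE x in M. complex_cond_exp M F (\<lambda>x. \<Sum>i\<in>I. C i x * complex_of_real (X i x)) x
           = (\<Sum>i\<in>I. C i x * complex_of_real (expectation (X i)))"
proof -
  have "AE x in M. real_cond_exp M F (\<lambda>x. \<Sum>i\<in>I. Re (C i x) * X i x) x
           = (\<Sum>i\<in>I. Re (C i x) * expectation (X i))"
    by (rule real_cond_exp_predictable_combination[OF sub I X ind]) simp
  moreover have "AE x in M. real_cond_exp M F (\<lambda>x. \<Sum>i\<in>I. Im (C i x) * X i x) x
           = (\<Sum>i\<in>I. Im (C i x) * expectation (X i))"
    by (rule real_cond_exp_predictable_combination[OF sub I X ind]) simp
  ultimately show ?thesis
    by eventually_elim (simp add: complex_cond_exp_def complex_eq_iff)
qed

section \<open>The past is independent of the current impulse\<close>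

lemma (in prob_space) subalgebra_past:
  assumes "\<And>k. P k \<in> borel_measurable M"
  shows "subalgebra M (past M P m)"
proof -
  have "(\<Union>k<m. {P k -` A \<inter> space M | A. A \<in> sets borel}) \<subseteq> events"
    using assms by auto
  then show ?thesis
    unfolding subalgebra_def past_def
    using sets.space_closed[of M] by (auto simp: space_measure_of_conv sets_measure_of_conv
        intro: sets.sigma_sets_subset[THEN subsetD])
qed

text \<open>The past is generated by the disjoint group of indices \<open>{..<m}\<close> of the independent family, the
  present by the group \<open>{m}\<close>, so the independence of disjoint groups applies.\<close>

lemma (in prob_space) indep_set_past:
  fixes P :: "nat \<Rightarrow> 'a \<Rightarrow> 'b::topological_space"
  assumes ind: "indep_vars (\<lambda>_. borel) P (UNIV :: nat set)"
  shows "indep_set (sets (past M P m)) (sets (vimage_algebra (space M) (P m) borel))"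
proof -
  define E where "E k = {P k -` A \<inter> space M | A. A \<in> sets borel}" for k
  have Epow: "E k \<subseteq> Pow (space M)" for k
    by (auto simp: E_def)
  have past: "sets (past M P m) = sigma_sets (space M) (\<Union>k<m. E k)"
    unfolding past_def E_def[symmetric] by (rule sets_measure_of) (use Epow in blast)
  have E: "indep_sets E UNIV"
    using ind unfolding indep_vars_def2 E_def by simp
  have stable: "Int_stable (E k)" for k
    unfolding Int_stable_def E_def
  proof safe
    fix A B :: "'b set"
    assume "A \<in> sets borel" "B \<in> sets borel"
    then show "\<exists>D. P k -` A \<inter> space M \<inter> (P k -` B \<inter> space M) = P k -` D \<inter> space M \<and> D \<in> sets borel"
      by (intro exI[of _ "A \<inter> B"]) auto
  qed
  have "indep_sets (\<lambda>j. sigma_sets (space M) (\<Union>k\<in>case_bool {..<m} {m} j. E k)) UNIV"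
  proof (rule indep_sets_collect_sigma)
    show "indep_sets E (\<Union>j\<in>UNIV. case_bool {..<m} {m} j)"
      by (rule indep_sets_mono_index[OF _ E]) simp
    show "disjoint_family_on (case_bool {..<m} {m}) UNIV"
      by (auto simp: disjoint_family_on_def split: bool.splits)
  qed (rule stable)
  then show ?thesis
    unfolding indep_set_def past sets_vimage_algebra E_def[of m, symmetric]
    by (rule indep_sets_cong[THEN iffD1, rotated 2]) (auto split: bool.splits)
qed

section \<open>Second moments\<close>

lemma (in prob_space) integrable_product_of_fourth_moments:
  fixes X Y :: "'a \<Rightarrow> real"
  assumes [measurable]: "X \<in> borel_measurable M" "Y \<in> borel_measurable M"
    and X: "integrable M (\<lambda>x. X x ^ 4)" and Y: "integrable M (\<lambda>x. Y x ^ 4)"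
  shows "integrable M (\<lambda>x. X x * Y x)"
proof (rule Bochner_Integration.integrable_bound)
  show "integrable M (\<lambda>x. 1 + X x ^ 4 + Y x ^ 4)"
    using X Y by auto
  have "\<bar>a * b\<bar> \<le> 1 + a ^ 4 + b ^ 4" for a b :: real
  proof -
    have "2 * \<bar>a * b\<bar> \<le> a\<^sup>2 + b\<^sup>2"
      using sum_squares_bound[of "\<bar>a\<bar>" "\<bar>b\<bar>"] by (simp add: abs_mult)
    moreover have "2 * a\<^sup>2 \<le> 1 + a ^ 4" "2 * b\<^sup>2 \<le> 1 + b ^ 4"
      using sum_squares_bound[of "a\<^sup>2" 1] sum_squares_bound[of "b\<^sup>2" 1] by simp_all
    moreover have "0 \<le> a ^ 4" "0 \<le> b ^ 4" by simp_all
    ultimately show ?thesis by linarith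
  qed
  note b = this
  have "0 \<le> 1 + a ^ 4 + b ^ 4" for a b :: real
    by (intro add_nonneg_nonneg) simp_all
  then show "AE x in M. norm (X x * Y x) \<le> norm (1 + X x ^ 4 + Y x ^ 4)"
    using b by auto
qed auto

lemma (in prob_space) expectation_product_centered_iid:
  fixes X :: "'i \<Rightarrow> 'a \<Rightarrow> real"
  assumes ind: "indep_vars (\<lambda>_. borel) X UNIV"
    and int: "\<And>k. integrable M (X k)" and mean: "\<And>k. expectation (X k) = 0"
    and law: "\<And>k l. distr M borel (X k) = distr M borel (X l)"
  shows "expectation (\<lambda>x. X k x * X l x) = (if k = l then expectation (\<lambda>x. (X s x)\<^sup>2) else 0)"
proof (cases "k = l")
  case True
  have rv [measurable]: "X k \<in> borel_measurable M" for k
    using int by auto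
  have "expectation (\<lambda>x. (X k x)\<^sup>2) = (\<integral>y. y\<^sup>2 \<partial>distr M borel (X k))" for k
    by (rule integral_distr[symmetric]) auto
  then show ?thesis
    using law[of k s] True by (simp add: power2_eq_square)
next
  case False
  have "expectation (\<lambda>x. \<Prod>j\<in>{k, l}. X j x) = (\<Prod>j\<in>{k, l}. expectation (X j))"
    by (rule indep_vars_lebesgue_integral) (auto intro: int indep_vars_subset[OF ind])
  then show ?thesis using False by (simp add: mean)
qed

section \<open>The force as a quadratic form in the entries of the impulse\<close>

lemma impulse_on_interval:
  assumes "strict_mono t" "\<tau> \<in> {t m..<t (Suc m)}"
  shows "impulse \<epsilon> t P \<tau> \<omega> = window \<epsilon> (t m) (t (Suc m)) \<tau> *\<^sub>R P m \<omega>"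
proof -
  have "window \<epsilon> (t k) (t (Suc k)) \<tau> = 0" if "k \<noteq> m" for k
  proof -
    have "Suc m \<le> k \<or> Suc k \<le> m" using that by auto
    then have "t (Suc m) \<le> t k \<or> t (Suc k) \<le> t m"
      using strict_mono_less_eq[OF assms(1)] by blast
    then show ?thesis using assms(2) by (auto simp: window_def)
  qed
  then show ?thesis
    unfolding impulse_def by (subst suminf_finite[of "{m}"]) auto
qed

definition coupling_coeff ::
  "('n \<Rightarrow> complex^'n) \<Rightarrow> ('n \<Rightarrow> complex^'n) \<Rightarrow> 'n \<Rightarrow> 'n \<Rightarrow> 'n \<times> 'n \<Rightarrow> complex" where
  "coupling_coeff v u i j p = cnj (u i $ fst p) * v j $ snd p"

lemma coupling_cmatrix:
  "coupling (cmatrix A) v u i j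
     = (\<Sum>p\<in>UNIV. coupling_coeff v u i j p * complex_of_real (A $ fst p $ snd p))"
proof -
  have "coupling (cmatrix A) v u i j
      = (\<Sum>a\<in>UNIV. \<Sum>b\<in>UNIV. cnj (u i $ a) * v j $ b * complex_of_real (A $ a $ b))"
    by (simp add: coupling_def herm_def matrix_vector_mult_def sum_distrib_left mult_ac)
  also have "\<dots> = (\<Sum>p\<in>UNIV \<times> UNIV. cnj (u i $ fst p) * v j $ snd p * complex_of_real (A $ fst p $ snd p))"
    unfolding sum.cartesian_product by (simp add: split_def)
  finally show ?thesis by (simp add: coupling_coeff_def)
qed

text \<open>The index is a pair of positions, one for the entry met in the coupling of \<open>i\<close> to \<open>j\<close> and one for
  the entry met in the coupling of \<open>j\<close> to \<open>i\<close>.\<close>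

definition force_coeff ::
  "('n \<Rightarrow> complex) \<Rightarrow> ('n \<Rightarrow> complex^'n) \<Rightarrow> ('n \<Rightarrow> complex^'n) \<Rightarrow> 'n \<Rightarrow> 'n
     \<Rightarrow> ('n \<times> 'n) \<times> ('n \<times> 'n) \<Rightarrow> complex" where
  "force_coeff lam v u i j pq =
     2 * coupling_coeff v u i j (fst pq) * coupling_coeff v u j i (snd pq) / (lam i - lam j)"

lemma force_cmatrix:
  "force (cmatrix (w *\<^sub>R A)) lam v u i j =
     (\<Sum>pq\<in>UNIV. complex_of_real (w\<^sup>2) * force_coeff lam v u i j pq
        * complex_of_real (A $ fst (fst pq) $ snd (fst pq) * A $ fst (snd pq) $ snd (snd pq)))"
proof -
  let ?a = "\<lambda>p. coupling_coeff v u i j p * complex_of_real (A $ fst p $ snd p)"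
  let ?b = "\<lambda>q. coupling_coeff v u j i q * complex_of_real (A $ fst q $ snd q)"
  have c: "coupling (cmatrix (w *\<^sub>R A)) v u i j = complex_of_real w * coupling (cmatrix A) v u i j" for i j
    unfolding coupling_cmatrix by (simp add: sum_distrib_left mult_ac)
  have "force (cmatrix (w *\<^sub>R A)) lam v u i j
      = 2 * (complex_of_real w)\<^sup>2 / (lam i - lam j) * (sum ?a UNIV * sum ?b UNIV)"
    unfolding force_def c unfolding coupling_cmatrix by (simp add: power2_eq_square mult_ac)
  also have "sum ?a UNIV * sum ?b UNIV = (\<Sum>pq\<in>UNIV \<times> UNIV. ?a (fst pq) * ?b (snd pq))"
    unfolding sum_product sum.cartesian_product by (simp add: split_def)
  finally show ?thesis
    by (simp add: sum_distrib_left force_coeff_def mult_ac)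
qed

lemma borel_measurable_force_coeff:
  assumes [measurable]: "\<And>i. (\<lambda>x. lam x i) \<in> borel_measurable F"
    and v: "\<And>i. (\<lambda>x. v x i) \<in> borel_measurable F" and u: "\<And>i. (\<lambda>x. u x i) \<in> borel_measurable F"
  shows "(\<lambda>x. force_coeff (lam x) (v x) (u x) i j pq) \<in> borel_measurable F"
proof -
  have nth: "(\<lambda>y :: complex^'n. y $ k) \<in> borel_measurable borel" for k
    by (intro borel_measurable_continuous_onI continuous_intros)
  have cnj: "cnj \<in> borel_measurable borel"
    by (intro borel_measurable_continuous_onI continuous_intros)
  have [measurable]: "(\<lambda>x. v x i $ k) \<in> borel_measurable F" for i k
    by (rule measurable_compose[OF v nth])
  have [measurable]: "(\<lambda>x. cnj (u x i $ k)) \<in> borel_measurable F" for i k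
    by (rule measurable_compose[OF measurable_compose[OF u nth] cnj])
  show ?thesis
    unfolding force_coeff_def coupling_coeff_def by measurable
qed

section \<open>Conjugate eigenvalues\<close>

lemma poly_charpoly: "poly (charpoly A) z = det (mat z - A)"
  unfolding charpoly_def det_def
  by (auto simp: poly_sum poly_prod mat_def intro!: sum.cong prod.cong)

lemma charpoly_cmatrix_cnj_root:
  assumes "poly (charpoly (cmatrix A)) z = 0"
  shows "poly (charpoly (cmatrix A)) (cnj z) = 0"
proof -
  have "det (mat (cnj z) - cmatrix A) = cnj (det (mat z - cmatrix A))"
    unfolding det_def by (auto simp: mat_def intro!: sum.cong prod.cong)
  then show ?thesis using assms by (simp add: poly_charpoly)
qed

lemma eigen_system_conjugate_index:
  assumes "eigen_system (cmatrix A) lam v u"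
  obtains j where "lam j = cnj (lam i)"
proof -
  have b: "bij_betw lam UNIV {z. poly (charpoly (cmatrix A)) z = 0}"
    using assms by (simp add: eigen_system_def)
  then have "lam i \<in> {z. poly (charpoly (cmatrix A)) z = 0}"
    by (rule bij_betwE[THEN bspec]) simp
  then have "cnj (lam i) \<in> lam ` UNIV"
    using charpoly_cmatrix_cnj_root b by (auto simp: bij_betw_def)
  with that show thesis by (metis imageE)
qed

lemma norm_sq_vec: "(norm (x :: complex^'n))\<^sup>2 = (\<Sum>k\<in>UNIV. (cmod (x $ k))\<^sup>2)"
  by (simp add: norm_vec_def L2_set_def sum_nonneg)

text \<open>With conjugate eigenvectors, the product of the two coupling coefficients at one position
  pairs each component of \<open>u\<^sub>i\<close> and of \<open>v\<^sub>i\<close> with its own conjugate, leaving squared moduli; the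
  normalisation of \<open>v\<^sub>i\<close> then removes the right eigenvector from the result.\<close>

lemma sum_force_coeff_diagonal:
  assumes e: "eigen_system A lam v u" and c: "lam j = cnj (lam i)" and im: "Im (lam i) \<noteq> 0"
  shows "(\<Sum>p\<in>UNIV. force_coeff lam v u i j (p, p))
    = - \<i> * complex_of_real ((norm (u i))\<^sup>2 / Im (lam i))"
proof -
  have vu: "v j = cnj_vec (v i)" "u j = cnj_vec (u i)" "norm (v i) = 1"
    using e c unfolding eigen_system_def by blast+
  have "coupling_coeff v u i j p * coupling_coeff v u j i p
      = complex_of_real ((cmod (u i $ fst p))\<^sup>2 * (cmod (v i $ snd p))\<^sup>2)" for p
  proof -
    have "coupling_coeff v u i j p * coupling_coeff v u j i p
        = (u i $ fst p * cnj (u i $ fst p)) * (v i $ snd p * cnj (v i $ snd p))"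
      by (simp add: coupling_coeff_def vu cnj_vec_def mult_ac)
    then show ?thesis by (simp flip: complex_norm_square)
  qed
  then have "(\<Sum>p\<in>UNIV. coupling_coeff v u i j p * coupling_coeff v u j i p)
      = complex_of_real (\<Sum>p\<in>UNIV \<times> UNIV. (cmod (u i $ fst p))\<^sup>2 * (cmod (v i $ snd p))\<^sup>2)"
    by simp
  also have "(\<Sum>p\<in>UNIV \<times> UNIV. (cmod (u i $ fst p))\<^sup>2 * (cmod (v i $ snd p))\<^sup>2)
      = (norm (u i))\<^sup>2 * (norm (v i))\<^sup>2"
    unfolding norm_sq_vec sum_product sum.cartesian_product by (simp add: split_def)
  finally have s: "(\<Sum>p\<in>UNIV. coupling_coeff v u i j p * coupling_coeff v u j i p)
      = complex_of_real ((norm (u i))\<^sup>2)"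
    by (simp add: vu)
  have "lam i - lam j = 2 * \<i> * complex_of_real (Im (lam i))"
    by (simp add: c complex_eq_iff)
  then have "(\<Sum>p\<in>UNIV. force_coeff lam v u i j (p, p))
      = 2 / (2 * \<i> * complex_of_real (Im (lam i))) * complex_of_real ((norm (u i))\<^sup>2)"
    unfolding s[symmetric] by (simp add: force_coeff_def sum_distrib_left mult.assoc)
  also have "\<dots> = - \<i> * complex_of_real ((norm (u i))\<^sup>2 / Im (lam i))"
    using im by (simp add: field_simps)
  finally show ?thesis .
qed

section \<open>Expected force between conjugate eigenvalues\<close>

theorem corollary3:
  fixes \<Omega> :: "'a measure"
    and P :: "nat \<Rightarrow> 'a \<Rightarrow> real^'n^'n"
    and t :: "nat \<Rightarrow> real"
    and \<epsilon> \<tau> :: real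
    and m :: nat
    and M0 :: "real^'n^'n"
    and M :: "real \<Rightarrow> 'a \<Rightarrow> real^'n^'n"
    and lam :: "'a \<Rightarrow> 'n \<Rightarrow> complex"
    and v u :: "'a \<Rightarrow> 'n \<Rightarrow> complex^'n"
    and r c :: 'n
  assumes "prob_space \<Omega>"
    and "t 0 = 0" and "strict_mono t"
    and "0 < \<epsilon>" and "\<And>k. \<epsilon> < (t (Suc k) - t k) / 2"
    and "prob_space.indep_vars \<Omega> (\<lambda>_. borel) P UNIV"
    and "\<And>k. prob_space.indep_vars \<Omega> (\<lambda>_. borel) (\<lambda>(a, b) \<omega>. P k \<omega> $ a $ b) UNIV"
    and "\<And>k a b a' b'. distr \<Omega> borel (\<lambda>\<omega>. P k \<omega> $ a $ b) = distr \<Omega> borel (\<lambda>\<omega>. P k \<omega> $ a' $ b')"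
    and "\<And>k a b. integrable \<Omega> (\<lambda>\<omega>. (P k \<omega> $ a $ b) ^ 4)"
    and "\<And>k a b. prob_space.expectation \<Omega> (\<lambda>\<omega>. P k \<omega> $ a $ b) = 0"
    and "\<And>\<omega>. \<omega> \<in> space \<Omega> \<Longrightarrow> M 0 \<omega> = M0"
    and "\<And>\<omega> s. \<omega> \<in> space \<Omega> \<Longrightarrow> 0 \<le> s \<Longrightarrow>
           ((\<lambda>s. M s \<omega>) has_vector_derivative impulse \<epsilon> t P s \<omega>) (at s within {0..})"
    and "\<tau> \<in> {t m..<t (Suc m)}"
    and "\<And>i. (\<lambda>\<omega>. lam \<omega> i) \<in> borel_measurable (past \<Omega> P m)"
    and "\<And>i. (\<lambda>\<omega>. v \<omega> i) \<in> borel_measurable (past \<Omega> P m)"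
    and "\<And>i. (\<lambda>\<omega>. u \<omega> i) \<in> borel_measurable (past \<Omega> P m)"
  shows "AE \<omega> in \<Omega>.
    simple_spectrum (cmatrix (M (t m) \<omega>)) \<and>
    eigen_system (cmatrix (M (t m) \<omega>)) (lam \<omega>) (v \<omega>) (u \<omega>) \<longrightarrow>
    (\<forall>i. Im (lam \<omega> i) \<noteq> 0 \<longrightarrow>
      (\<exists>j. lam \<omega> j = cnj (lam \<omega> i) \<and>
        nn_cond_exp \<Omega> (past \<Omega> P m)
          (\<lambda>\<omega>'. ennreal (cmod (force (cmatrix (impulse \<epsilon> t P \<tau> \<omega>')) (lam \<omega>') (v \<omega>') (u \<omega>') i j))) \<omega> < \<infinity> \<and>
        complex_cond_exp \<Omega> (past \<Omega> P m)
          (\<lambda>\<omega>'. force (cmatrix (impulse \<epsilon> t P \<tau> \<omega>')) (lam \<omega>') (v \<omega>') (u \<omega>') i j) \<omega> =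
        - \<i> * complex_of_real
          (prob_space.variance \<Omega> (\<lambda>\<omega>'. impulse \<epsilon> t P \<tau> \<omega>' $ r $ c)
             * (norm (u \<omega> i))\<^sup>2 / Im (lam \<omega> i))))"
proof -
  interpret prob_space \<Omega> by fact
  let ?F = "past \<Omega> P m"
  define w where "w = window \<epsilon> (t m) (t (Suc m)) \<tau>"
  define p where "p q \<omega> = P m \<omega> $ fst q $ snd q" for q \<omega>
  define C where "C i j pq \<omega> = complex_of_real (w\<^sup>2) * force_coeff (lam \<omega>) (v \<omega>) (u \<omega>) i j pq"
    for i j pq \<omega>
  define \<sigma>2 where "\<sigma>2 = expectation (\<lambda>\<omega>. (p (r, c) \<omega>)\<^sup>2)"
  have impulse: "impulse \<epsilon> t P \<tau> = (\<lambda>\<omega>. w *\<^sub>R P m \<omega>)"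
    unfolding w_def using impulse_on_interval[OF assms(3) assms(13)] by (rule ext)
  have Prv [measurable]: "P k \<in> borel_measurable \<Omega>" for k
    using assms(6) by (simp add: indep_vars_def)
  have sub: "subalgebra \<Omega> ?F"
    by (rule subalgebra_past) (rule Prv)
  have p_cont: "continuous_on UNIV (\<lambda>A :: real^'n^'n. A $ fst q $ snd q)" for q
    by (intro continuous_intros)
  have p_fun: "(\<lambda>A :: real^'n^'n. A $ fst q $ snd q) \<in> borel_measurable borel" for q
    by (rule borel_measurable_continuous_onI) (rule p_cont)
  have p_rv [measurable]: "p q \<in> borel_measurable \<Omega>" for q
    unfolding p_def by (rule measurable_compose[OF Prv p_fun])
  have p_eq: "(\<lambda>(a, b) \<omega>. P m \<omega> $ a $ b) = p"
    by (auto simp: p_def fun_eq_iff)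
  have p_ind: "indep_vars (\<lambda>_. borel) p UNIV"
    using assms(7)[of m] unfolding p_eq .
  have p4: "integrable \<Omega> (\<lambda>\<omega>. p q \<omega> ^ 4)" for q
    unfolding p_def by (rule assms(9))
  have pp_int: "integrable \<Omega> (\<lambda>\<omega>. p (fst pq) \<omega> * p (snd pq) \<omega>)" for pq
    by (rule integrable_product_of_fourth_moments) (auto intro: p4)
  have p_int: "integrable \<Omega> (p q)" for q
    using integrable_product_of_fourth_moments[OF p_rv _ p4, of "\<lambda>_. 1" q] by simp
  have p_mean: "expectation (p q) = 0" for q
    unfolding p_def by (rule assms(10))
  have p_law: "distr \<Omega> borel (p k) = distr \<Omega> borel (p l)" for k l
    unfolding p_def by (rule assms(8))
  have pp_exp: "expectation (\<lambda>\<omega>. p (fst pq) \<omega> * p (snd pq) \<omega>)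
      = (if fst pq = snd pq then \<sigma>2 else 0)" for pq
    unfolding \<sigma>2_def by (rule expectation_product_centered_iid[OF p_ind p_int p_mean p_law])
  have pp_ind: "indep_set (sets ?F)
      (sets (vimage_algebra (space \<Omega>) (\<lambda>\<omega>. p (fst pq) \<omega> * p (snd pq) \<omega>) borel))" for pq
  proof -
    have "P m \<in> borel_measurable (vimage_algebra (space \<Omega>) (P m) borel)"
      by (rule measurable_vimage_algebra1) simp
    then have "p q \<in> borel_measurable (vimage_algebra (space \<Omega>) (P m) borel)" for q
      unfolding p_def by (rule measurable_compose[OF _ p_fun])
    then have "(\<lambda>\<omega>. p (fst pq) \<omega> * p (snd pq) \<omega>)
        \<in> borel_measurable (vimage_algebra (space \<Omega>) (P m) borel)"
      by (intro borel_measurable_times)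
    then show ?thesis
      by (intro indep_set_mono[OF indep_set_past[OF assms(6)]] order_refl sets_image_in_sets) simp_all
  qed
  have C_meas: "C i j pq \<in> borel_measurable ?F" for i j pq
    unfolding C_def
    by (intro borel_measurable_times borel_measurable_const borel_measurable_force_coeff assms(14-16))
  have force_eq: "force (cmatrix (impulse \<epsilon> t P \<tau> \<omega>)) (lam \<omega>) (v \<omega>) (u \<omega>) i j
      = (\<Sum>pq\<in>UNIV. C i j pq \<omega> * complex_of_real (p (fst pq) \<omega> * p (snd pq) \<omega>))" for i j \<omega>
    unfolding impulse force_cmatrix by (simp add: C_def p_def)
  have variance: "variance (\<lambda>\<omega>. impulse \<epsilon> t P \<tau> \<omega> $ r $ c) = w\<^sup>2 * \<sigma>2"
  proof -
    have e: "impulse \<epsilon> t P \<tau> \<omega> $ r $ c = w * p (r, c) \<omega>" for \<omega>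
      by (simp add: impulse p_def)
    have z: "expectation (\<lambda>\<omega>. w * p (r, c) \<omega>) = 0"
      by (simp add: p_mean)
    show ?thesis
      unfolding e z \<sigma>2_def by (simp add: power_mult_distrib)
  qed
  \<comment> \<open>All pairs \<open>(i, j)\<close> share one null set, because the conjugate index \<open>j\<close> varies with \<open>\<omega>\<close>.\<close>
  have "AE \<omega> in \<Omega>. \<forall>ij\<in>UNIV.
      nn_cond_exp \<Omega> ?F (\<lambda>\<omega>'. ennreal (cmod (force (cmatrix (impulse \<epsilon> t P \<tau> \<omega>'))
          (lam \<omega>') (v \<omega>') (u \<omega>') (fst ij) (snd ij)))) \<omega> < \<infinity> \<and>
      complex_cond_exp \<Omega> ?F (\<lambda>\<omega>'. force (cmatrix (impulse \<epsilon> t P \<tau> \<omega>'))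
          (lam \<omega>') (v \<omega>') (u \<omega>') (fst ij) (snd ij)) \<omega>
        = (\<Sum>pq\<in>UNIV. C (fst ij) (snd ij) pq \<omega>
             * complex_of_real (expectation (\<lambda>\<omega>. p (fst pq) \<omega> * p (snd pq) \<omega>)))"
    unfolding force_eq
    by (intro AE_finite_allI AE_conjI nn_cond_exp_predictable_combination_finite[OF sub]
        complex_cond_exp_predictable_combination[OF sub] pp_int pp_ind C_meas finite)
  then show ?thesis
  proof eventually_elim
    case (elim \<omega>)
    show ?case
    proof (intro impI allI)
      fix i
      assume eig: "simple_spectrum (cmatrix (M (t m) \<omega>)) \<and>
          eigen_system (cmatrix (M (t m) \<omega>)) (lam \<omega>) (v \<omega>) (u \<omega>)"
        and im: "Im (lam \<omega> i) \<noteq> 0"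
      then obtain j where j: "lam \<omega> j = cnj (lam \<omega> i)"
        using eigen_system_conjugate_index by blast
      have "(\<Sum>pq\<in>UNIV. C i j pq \<omega>
             * complex_of_real (expectation (\<lambda>\<omega>. p (fst pq) \<omega> * p (snd pq) \<omega>)))
          = (\<Sum>k\<in>UNIV. \<Sum>l\<in>UNIV. C i j (k, l) \<omega> * (if k = l then complex_of_real \<sigma>2 else 0))"
        unfolding pp_exp sum.cartesian_product UNIV_Times_UNIV
        by (intro sum.cong) auto
      also have "\<dots> = (\<Sum>k\<in>UNIV. C i j (k, k) \<omega> * complex_of_real \<sigma>2)"
        by (intro sum.cong refl) (simp add: if_distrib[of "\<lambda>x. _ * x"] cong: if_cong)
      also have "\<dots> = complex_of_real (w\<^sup>2 * \<sigma>2)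
          * (\<Sum>k\<in>UNIV. force_coeff (lam \<omega>) (v \<omega>) (u \<omega>) i j (k, k))"
        by (simp add: C_def sum_distrib_left mult_ac)
      also have "\<dots> = - \<i> * complex_of_real (w\<^sup>2 * \<sigma>2 * (norm (u \<omega> i))\<^sup>2 / Im (lam \<omega> i))"
        using sum_force_coeff_diagonal[OF conjunct2[OF eig] j im] by simp
      finally have "(\<Sum>pq\<in>UNIV. C i j pq \<omega>
             * complex_of_real (expectation (\<lambda>\<omega>. p (fst pq) \<omega> * p (snd pq) \<omega>)))
          = - \<i> * complex_of_real (w\<^sup>2 * \<sigma>2 * (norm (u \<omega> i))\<^sup>2 / Im (lam \<omega> i))" .
      then show "\<exists>j. lam \<omega> j = cnj (lam \<omega> i) \<and>
        nn_cond_exp \<Omega> ?F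
          (\<lambda>\<omega>'. ennreal (cmod (force (cmatrix (impulse \<epsilon> t P \<tau> \<omega>')) (lam \<omega>') (v \<omega>') (u \<omega>') i j))) \<omega> < \<infinity> \<and>
        complex_cond_exp \<Omega> ?F
          (\<lambda>\<omega>'. force (cmatrix (impulse \<epsilon> t P \<tau> \<omega>')) (lam \<omega>') (v \<omega>') (u \<omega>') i j) \<omega> =
        - \<i> * complex_of_real
          (variance (\<lambda>\<omega>'. impulse \<epsilon> t P \<tau> \<omega>' $ r $ c) * (norm (u \<omega> i))\<^sup>2 / Im (lam \<omega> i))"
        unfolding variance using elim[THEN bspec, of "(i, j)"] j by auto
    qed
  qed
qed

end
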